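(* Let $1/2<q<1$ and let $s$ be the ultrametric on $\mathbb{Q}_2^2$ given by $s(x,y)=\max\left(q|x_1-y_1|_2,\ |x_2-y_2|_2\right)$. Let $U=\begin{pmatrix}1&0\\1&1\end{pmatrix}$ and consider the metric on $\mathbb{Q}_2^2$ $$\mathbf{q}(x,y)=s(Ux,Uy)=\max\left(q|x_1-y_1|_2,\ |x_1+x_2-y_1-y_2|_2\right).$$ Then the quincunx matrix $Q=\begin{pmatrix}1&-1\\1&1\end{pmatrix}$ is a dilation of $\mathbb{Q}_2^2$ with respect to the metric $\mathbf{q}$.
   Context: A dilation of $\mathbb{Q}_2^2$ with respect to an ultrametric is a linear map $\mathbb{Q}_2^2\to\mathbb{Q}_2^2$ which maps any ball (of positive radius) with center at zero onto a maximal proper subball with center at zero of this ball, balls being taken with respect to the given ultrametric. *)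

theory Defs
  imports "HOL-Analysis.Analysis" "HOL-Computational_Algebra.Primes"
begin

section \<open>The 2-adic absolute value on the rationals\<close>

definition val2 :: "rat \<Rightarrow> int" where
  "val2 x = int (multiplicity 2 (fst (quotient_of x))) - int (multiplicity 2 (snd (quotient_of x)))"

definition rat_abs2 :: "rat \<Rightarrow> real" where
  "rat_abs2 x = (if x = 0 then 0 else 2 powi (- val2 x))"

lemma val2_frac:
  assumes "a \<noteq> 0" "b \<noteq> 0"
  shows "val2 (of_int a / of_int b) = int (multiplicity 2 a) - int (multiplicity 2 b)"
proof -
  obtain n d where q: "quotient_of (of_int a / of_int b :: rat) = (n, d)"
    by (cases "quotient_of (of_int a / of_int b :: rat)") auto
  have d: "d > 0" using quotient_of_denom_pos[OF q] .
  have eq: "of_int a / of_int b = (of_int n / of_int d :: rat)"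
    using quotient_of_div[OF q] .
  have "of_int (a * d) = (of_int (n * b) :: rat)"
    using eq assms d by (simp add: field_simps)
  then have e: "a * d = n * b" using of_int_eq_iff by blast
  then have n: "n \<noteq> 0" using assms d by auto
  have p: "prime_elem (2::int)" by simp
  have "multiplicity 2 a + multiplicity 2 d = multiplicity 2 n + multiplicity 2 b"
    using e prime_elem_multiplicity_mult_distrib[OF p, of a d]
      prime_elem_multiplicity_mult_distrib[OF p, of n b] assms d n by simp
  then show ?thesis by (simp add: val2_def q)
qed

lemma rat_frac_cases:
  obtains a b :: int where "b \<noteq> 0" "x = of_int a / (of_int b :: rat)"
  by (metis quotient_of_div quotient_of_denom_pos less_irrefl surj_pair)

lemma rat_abs2_zero [simp]: "rat_abs2 0 = 0"
  by (simp add: rat_abs2_def)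

lemma rat_abs2_nonneg [simp]: "0 \<le> rat_abs2 x"
  by (simp add: rat_abs2_def)

lemma rat_abs2_eq_0_iff [simp]: "rat_abs2 x = 0 \<longleftrightarrow> x = 0"
  by (simp add: rat_abs2_def)

lemma rat_abs2_mult: "rat_abs2 (x * y) = rat_abs2 x * rat_abs2 y"
proof (cases "x = 0 \<or> y = 0")
  case False
  obtain a b where x: "b \<noteq> 0" "x = of_int a / (of_int b :: rat)" by (rule rat_frac_cases)
  obtain c d where y: "d \<noteq> 0" "y = of_int c / (of_int d :: rat)" by (rule rat_frac_cases)
  have ac: "a \<noteq> 0" "c \<noteq> 0" using False x y by auto
  have p: "prime_elem (2::int)" by simp
  have "x * y = of_int (a * c) / of_int (b * d)" using x y by simp
  then have "val2 (x * y) = val2 x + val2 y"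
    using val2_frac[of "a * c" "b * d"] val2_frac[of a b] val2_frac[of c d] ac x y
      prime_elem_multiplicity_mult_distrib[OF p, of a c]
      prime_elem_multiplicity_mult_distrib[OF p, of b d] by simp
  then show ?thesis using False
    by (simp add: rat_abs2_def flip: power_int_add)
qed auto

lemma rat_abs2_one [simp]: "rat_abs2 1 = 1"
  using val2_frac[of 1 1] by (simp add: rat_abs2_def)

lemma rat_abs2_two: "rat_abs2 2 = 1 / 2"
  using val2_frac[of 2 1] by (simp add: rat_abs2_def power_int_minus)

lemma rat_abs2_minus [simp]: "rat_abs2 (- x) = rat_abs2 x"
proof -
  have "multiplicity 2 (- 1 :: int) = 0"
    by (rule not_dvd_imp_multiplicity_0) simp
  then have "rat_abs2 (- 1) = 1"
    using val2_frac[of "- 1" 1] by (simp add: rat_abs2_def)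
  then show ?thesis using rat_abs2_mult[of "- 1" x] by simp
qed

lemma rat_abs2_inverse: "rat_abs2 (inverse x) = inverse (rat_abs2 x)"
proof (cases "x = 0")
  case False
  then have "rat_abs2 x * rat_abs2 (inverse x) = 1"
    by (simp flip: rat_abs2_mult)
  then show ?thesis by (simp add: inverse_unique)
qed simp

lemma rat_abs2_add_le: "rat_abs2 (x + y) \<le> max (rat_abs2 x) (rat_abs2 y)"
proof (cases "x = 0 \<or> y = 0 \<or> x + y = 0")
  case True
  then show ?thesis by (auto simp: le_max_iff_disj)
next
  case False
  obtain a b where x: "b \<noteq> 0" "x = of_int a / (of_int b :: rat)" by (rule rat_frac_cases)
  obtain c d where y: "d \<noteq> 0" "y = of_int c / (of_int d :: rat)" by (rule rat_frac_cases)
  define u v w where "u = a * d" and "v = c * b" and "w = b * d"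
  have w: "w \<noteq> 0" using x y by (simp add: w_def)
  have xu: "x = of_int u / of_int w" and yv: "y = of_int v / of_int w"
    using x y by (simp_all add: u_def v_def w_def)
  then have xy: "x + y = of_int (u + v) / of_int w" by (simp add: add_divide_distrib)
  have nz: "u \<noteq> 0" "v \<noteq> 0" "u + v \<noteq> 0" using False xu yv xy by auto
  have "2 ^ min (multiplicity 2 u) (multiplicity 2 v) dvd u + v"
    by (intro dvd_add multiplicity_dvd') auto
  then have "min (multiplicity 2 u) (multiplicity 2 v) \<le> multiplicity 2 (u + v)"
    using nz by (intro multiplicity_geI) auto
  then have "val2 (x + y) \<ge> min (val2 x) (val2 y)"
    unfolding xy unfolding xu yv val2_frac[OF nz(1) w] val2_frac[OF nz(2) w] val2_frac[OF nz(3) w]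
    by linarith
  then have "- val2 (x + y) \<le> - val2 x \<or> - val2 (x + y) \<le> - val2 y" by linarith
  then have "(2::real) powi (- val2 (x + y)) \<le> 2 powi (- val2 x) \<or>
      (2::real) powi (- val2 (x + y)) \<le> 2 powi (- val2 y)"
    using power_int_increasing[of _ _ "2::real"] by fastforce
  then show ?thesis using False by (simp add: rat_abs2_def le_max_iff_disj)
qed

lemma rat_abs2_add: "rat_abs2 (x + y) \<le> rat_abs2 x + rat_abs2 y"
  using rat_abs2_add_le[of x y] rat_abs2_nonneg[of x] rat_abs2_nonneg[of y] by linarith

lemma rat_abs2_diff_abs: "\<bar>rat_abs2 x - rat_abs2 y\<bar> \<le> rat_abs2 (x - y)"
  using rat_abs2_add[of "x - y" y] rat_abs2_add[of "y - x" x] rat_abs2_minus[of "x - y"]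
  by simp


section \<open>The field of 2-adic numbers as the completion of the rationals\<close>

definition cauchy2 :: "(nat \<Rightarrow> rat) \<Rightarrow> bool" where
  "cauchy2 X \<longleftrightarrow> (\<forall>e>0. \<exists>N. \<forall>m\<ge>N. \<forall>n\<ge>N. rat_abs2 (X m - X n) < e)"

definition null2 :: "(nat \<Rightarrow> rat) \<Rightarrow> bool" where
  "null2 X \<longleftrightarrow> (\<lambda>n. rat_abs2 (X n)) \<longlonglongrightarrow> 0"

lemma null2_le:
  assumes "g \<longlonglongrightarrow> 0" "\<And>n. rat_abs2 (X n) \<le> g n"
  shows "null2 X"
  unfolding null2_def
  by (rule tendsto_sandwich[OF _ _ tendsto_const assms(1)]) (use assms(2) in auto)

lemma null2_zero: "null2 (\<lambda>n. 0)"
  by (simp add: null2_def)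

lemma null2_minus: "null2 X \<Longrightarrow> null2 (\<lambda>n. - X n)"
  by (simp add: null2_def)

lemma null2_add: "null2 X \<Longrightarrow> null2 Y \<Longrightarrow> null2 (\<lambda>n. X n + Y n)"
  by (rule null2_le[where g = "\<lambda>n. rat_abs2 (X n) + rat_abs2 (Y n)"])
     (auto simp: null2_def rat_abs2_add intro: tendsto_add_zero)

lemma null2_diff: "null2 X \<Longrightarrow> null2 Y \<Longrightarrow> null2 (\<lambda>n. X n - Y n)"
  using null2_add[OF _ null2_minus, of X Y] by simp

lemma cauchy2_const [simp]: "cauchy2 (\<lambda>n. x)"
  by (simp add: cauchy2_def)

lemma cauchy2_minus: "cauchy2 X \<Longrightarrow> cauchy2 (\<lambda>n. - X n)"
  unfolding cauchy2_def by (metis minus_diff_minus rat_abs2_minus)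

lemma cauchy2_add:
  assumes "cauchy2 X" "cauchy2 Y"
  shows "cauchy2 (\<lambda>n. X n + Y n)"
  unfolding cauchy2_def
proof (intro allI impI)
  fix e :: real assume "e > 0"
  obtain M where M: "\<forall>m\<ge>M. \<forall>n\<ge>M. rat_abs2 (X m - X n) < e"
    using assms(1) \<open>e > 0\<close> unfolding cauchy2_def by blast
  obtain N where N: "\<forall>m\<ge>N. \<forall>n\<ge>N. rat_abs2 (Y m - Y n) < e"
    using assms(2) \<open>e > 0\<close> unfolding cauchy2_def by blast
  have "rat_abs2 (X m + Y m - (X n + Y n)) < e" if "m \<ge> max M N" "n \<ge> max M N" for m n
  proof -
    have "rat_abs2 ((X m - X n) + (Y m - Y n)) \<le> max (rat_abs2 (X m - X n)) (rat_abs2 (Y m - Y n))"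
      by (rule rat_abs2_add_le)
    also have "\<dots> < e" using M N that by simp
    finally show ?thesis by (simp add: algebra_simps)
  qed
  then show "\<exists>N. \<forall>m\<ge>N. \<forall>n\<ge>N. rat_abs2 (X m + Y m - (X n + Y n)) < e" by blast
qed

lemma cauchy2_convergent:
  assumes "cauchy2 X"
  shows "convergent (\<lambda>n. rat_abs2 (X n))"
proof -
  have "Cauchy (\<lambda>n. rat_abs2 (X n))"
    unfolding Cauchy_def dist_real_def
  proof (intro allI impI)
    fix e :: real assume "e > 0"
    then obtain N where "\<forall>m\<ge>N. \<forall>n\<ge>N. rat_abs2 (X m - X n) < e"
      using assms unfolding cauchy2_def by blast
    then show "\<exists>N. \<forall>m\<ge>N. \<forall>n\<ge>N. \<bar>rat_abs2 (X m) - rat_abs2 (X n)\<bar> < e"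
      using rat_abs2_diff_abs by (meson le_less_trans)
  qed
  then show ?thesis by (rule real_Cauchy_convergent)
qed

lemma cauchy2_bounded:
  assumes "cauchy2 X"
  obtains B where "B > 0" "\<And>n. rat_abs2 (X n) \<le> B"
proof -
  have "Bseq (\<lambda>n. rat_abs2 (X n))"
    using cauchy2_convergent[OF assms] by (rule convergent_imp_Bseq)
  then obtain B where "B > 0" "\<And>n. norm (rat_abs2 (X n)) \<le> B" by (rule BseqE) blast
  then show ?thesis using that by simp
qed

lemma null2_mult_bounded:
  assumes "cauchy2 X" "null2 Y"
  shows "null2 (\<lambda>n. X n * Y n)"
proof -
  obtain B where B: "B > 0" "\<And>n. rat_abs2 (X n) \<le> B" by (rule cauchy2_bounded[OF assms(1)]) blast
  show ?thesis
  proof (rule null2_le)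
    show "(\<lambda>n. B * rat_abs2 (Y n)) \<longlonglongrightarrow> 0"
      using assms(2) unfolding null2_def by (rule tendsto_mult_right_zero)
    show "rat_abs2 (X n * Y n) \<le> B * rat_abs2 (Y n)" for n
      by (simp add: rat_abs2_mult B mult_right_mono)
  qed
qed

lemma cauchy2_mult:
  assumes "cauchy2 X" "cauchy2 Y"
  shows "cauchy2 (\<lambda>n. X n * Y n)"
  unfolding cauchy2_def
proof (intro allI impI)
  fix e :: real assume "e > 0"
  obtain A where A: "A > 0" "\<And>n. rat_abs2 (X n) \<le> A" by (rule cauchy2_bounded[OF assms(1)]) blast
  obtain B where B: "B > 0" "\<And>n. rat_abs2 (Y n) \<le> B" by (rule cauchy2_bounded[OF assms(2)]) blast
  have eB: "e / B > 0" and eA: "e / A > 0" using \<open>e > 0\<close> A B by auto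
  obtain M where M: "\<forall>m\<ge>M. \<forall>n\<ge>M. rat_abs2 (X m - X n) < e / B"
    using assms(1) eB unfolding cauchy2_def by blast
  obtain N where N: "\<forall>m\<ge>N. \<forall>n\<ge>N. rat_abs2 (Y m - Y n) < e / A"
    using assms(2) eA unfolding cauchy2_def by blast
  have "rat_abs2 (X m * Y m - X n * Y n) < e" if "m \<ge> max M N" "n \<ge> max M N" for m n
  proof -
    have 1: "rat_abs2 (X m * (Y m - Y n)) < e"
    proof -
      have "rat_abs2 (X m) * rat_abs2 (Y m - Y n) \<le> A * rat_abs2 (Y m - Y n)"
        by (simp add: A mult_right_mono)
      also have "\<dots> < A * (e / A)" using N that A(1) by (intro mult_strict_left_mono) auto
      finally show ?thesis using A(1) by (simp add: rat_abs2_mult)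
    qed
    have 2: "rat_abs2 ((X m - X n) * Y n) < e"
    proof -
      have "rat_abs2 (X m - X n) * rat_abs2 (Y n) \<le> rat_abs2 (X m - X n) * B"
        by (simp add: B mult_left_mono)
      also have "\<dots> < (e / B) * B" using M that B(1) by (intro mult_strict_right_mono) auto
      finally show ?thesis using B(1) by (simp add: rat_abs2_mult)
    qed
    have "X m * Y m - X n * Y n = X m * (Y m - Y n) + (X m - X n) * Y n"
      by (simp add: algebra_simps)
    then show ?thesis
      using rat_abs2_add_le[of "X m * (Y m - Y n)" "(X m - X n) * Y n"] 1 2 by simp
  qed
  then show "\<exists>N. \<forall>m\<ge>N. \<forall>n\<ge>N. rat_abs2 (X m * Y m - X n * Y n) < e" by blast
qed

lemma cauchy2_not_null2:
  assumes "cauchy2 X" "\<not> null2 X"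
  obtains b N where "b > 0" "\<And>n. n \<ge> N \<Longrightarrow> rat_abs2 (X n) > b"
proof -
  obtain L where L: "(\<lambda>n. rat_abs2 (X n)) \<longlonglongrightarrow> L"
    using cauchy2_convergent[OF assms(1)] by (auto simp: convergent_def)
  have "L \<ge> 0" using L by (rule LIMSEQ_le_const) auto
  moreover have "L \<noteq> 0" using L assms(2) by (auto simp: null2_def)
  ultimately have "L > 0" by simp
  then have "\<forall>\<^sub>F n in sequentially. rat_abs2 (X n) > L / 2"
    using L by (intro order_tendstoD(1)) auto
  then obtain N where "\<And>n. n \<ge> N \<Longrightarrow> rat_abs2 (X n) > L / 2"
    by (auto simp: eventually_sequentially)
  with \<open>L > 0\<close> show ?thesis by (intro that[of "L / 2" N]) auto
qed

lemma rat_abs2_inverse_diff_le: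
  assumes "b > 0" "rat_abs2 x > b" "rat_abs2 y > b"
  shows "rat_abs2 (inverse x - inverse y) \<le> rat_abs2 (x - y) / b\<^sup>2"
proof -
  have nz: "x \<noteq> 0" "y \<noteq> 0" using assms by auto
  have "inverse x - inverse y = - (x - y) * inverse (x * y)"
    using nz by (simp add: field_simps)
  then have "rat_abs2 (inverse x - inverse y) = rat_abs2 (x - y) / (rat_abs2 x * rat_abs2 y)"
    by (metis rat_abs2_mult rat_abs2_minus rat_abs2_inverse divide_inverse)
  also have "\<dots> \<le> rat_abs2 (x - y) / b\<^sup>2"
    using assms unfolding power2_eq_square
    by (intro divide_left_mono mult_mono mult_pos_pos) auto
  finally show ?thesis .
qed

lemma cauchy2_inverse:
  assumes "cauchy2 X" "\<not> null2 X"
  shows "cauchy2 (\<lambda>n. inverse (X n))"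
  unfolding cauchy2_def
proof (intro allI impI)
  fix e :: real assume "e > 0"
  obtain b M where b: "b > 0" "\<And>n. n \<ge> M \<Longrightarrow> rat_abs2 (X n) > b"
    by (rule cauchy2_not_null2[OF assms]) blast
  have "e * b\<^sup>2 > 0" using \<open>e > 0\<close> b by simp
  then obtain N where N: "\<forall>m\<ge>N. \<forall>n\<ge>N. rat_abs2 (X m - X n) < e * b\<^sup>2"
    using assms(1) unfolding cauchy2_def by blast
  have "rat_abs2 (inverse (X m) - inverse (X n)) < e" if "m \<ge> max M N" "n \<ge> max M N" for m n
  proof -
    have "rat_abs2 (inverse (X m) - inverse (X n)) \<le> rat_abs2 (X m - X n) / b\<^sup>2"
      using b that by (intro rat_abs2_inverse_diff_le) auto
    also have "\<dots> < e" using N that b(1) by (simp add: divide_less_eq)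
    finally show ?thesis .
  qed
  then show "\<exists>N. \<forall>m\<ge>N. \<forall>n\<ge>N. rat_abs2 (inverse (X m) - inverse (X n)) < e" by blast
qed

lemma null2_diff_inverse:
  assumes "cauchy2 X" "\<not> null2 X" "cauchy2 Y" "\<not> null2 Y" "null2 (\<lambda>n. X n - Y n)"
  shows "null2 (\<lambda>n. inverse (X n) - inverse (Y n))"
proof -
  obtain a M where a: "a > 0" "\<And>n. n \<ge> M \<Longrightarrow> rat_abs2 (X n) > a"
    by (rule cauchy2_not_null2[OF assms(1,2)]) blast
  obtain b N where b: "b > 0" "\<And>n. n \<ge> N \<Longrightarrow> rat_abs2 (Y n) > b"
    by (rule cauchy2_not_null2[OF assms(3,4)]) blast
  define c where "c = min a b"
  have c: "c > 0" using a b by (simp add: c_def)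
  have le: "rat_abs2 (inverse (X n) - inverse (Y n)) \<le> rat_abs2 (X n - Y n) / c\<^sup>2"
    if "n \<ge> max M N" for n
    using a(2)[of n] b(2)[of n] that c by (intro rat_abs2_inverse_diff_le) (auto simp: c_def)
  show ?thesis
    unfolding null2_def
  proof (rule Lim_null_comparison)
    show "(\<lambda>n. rat_abs2 (X n - Y n) / c\<^sup>2) \<longlonglongrightarrow> 0"
      using assms(5) unfolding null2_def by (rule tendsto_divide_zero)
    show "\<forall>\<^sub>F n in sequentially.
        norm (rat_abs2 (inverse (X n) - inverse (Y n))) \<le> rat_abs2 (X n - Y n) / c\<^sup>2"
      using le
      unfolding eventually_sequentially real_norm_def abs_of_nonneg[OF rat_abs2_nonneg] by blast
  qed
qed

definition rel2 :: "(nat \<Rightarrow> rat) \<Rightarrow> (nat \<Rightarrow> rat) \<Rightarrow> bool" where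
  "rel2 X Y \<longleftrightarrow> cauchy2 X \<and> cauchy2 Y \<and> null2 (\<lambda>n. X n - Y n)"

lemma rel2_refl: "cauchy2 X \<Longrightarrow> rel2 X X"
  by (simp add: rel2_def null2_zero)

lemma part_equivp_rel2: "part_equivp rel2"
proof (rule part_equivpI)
  show "\<exists>X. rel2 X X" by (rule exI[of _ "\<lambda>n. 0"]) (simp add: rel2_refl)
  show "symp rel2"
    by (rule sympI) (use null2_minus in \<open>fastforce simp: rel2_def\<close>)
  show "transp rel2"
    by (rule transpI) (use null2_add in \<open>fastforce simp: rel2_def\<close>)
qed

quotient_type Q2 = "nat \<Rightarrow> rat" / partial: rel2
  morphisms rep_Q2 Q2
  by (rule part_equivp_rel2)

lemma rel2_null2_iff:
  assumes "rel2 X Y"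
  shows "null2 X \<longleftrightarrow> null2 Y"
proof
  assume "null2 X"
  from null2_diff[OF this, of "\<lambda>n. X n - Y n"] assms show "null2 Y" by (simp add: rel2_def)
next
  assume "null2 Y"
  from null2_add[OF this, of "\<lambda>n. X n - Y n"] assms show "null2 X" by (simp add: rel2_def)
qed

instantiation Q2 :: field
begin

lift_definition zero_Q2 :: Q2 is "\<lambda>n. 0"
  by (simp add: rel2_refl)

lift_definition one_Q2 :: Q2 is "\<lambda>n. 1"
  by (simp add: rel2_refl)

lift_definition plus_Q2 :: "Q2 \<Rightarrow> Q2 \<Rightarrow> Q2" is "\<lambda>X Y n. X n + Y n"
  unfolding rel2_def add_diff_add by (simp add: cauchy2_add null2_add)

lift_definition uminus_Q2 :: "Q2 \<Rightarrow> Q2" is "\<lambda>X n. - X n"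
  unfolding rel2_def minus_diff_minus by (simp only: cauchy2_minus null2_minus simp_thms)

lift_definition times_Q2 :: "Q2 \<Rightarrow> Q2 \<Rightarrow> Q2" is "\<lambda>X Y n. X n * Y n"
proof -
  fix X X' Y Y' :: "nat \<Rightarrow> rat"
  assume *: "rel2 X X'" "rel2 Y Y'"
  then have "null2 (\<lambda>n. X n * (Y n - Y' n) + Y' n * (X n - X' n))"
    by (intro null2_add null2_mult_bounded) (auto simp: rel2_def)
  then show "rel2 (\<lambda>n. X n * Y n) (\<lambda>n. X' n * Y' n)"
    using * by (simp add: rel2_def cauchy2_mult algebra_simps)
qed

lift_definition inverse_Q2 :: "Q2 \<Rightarrow> Q2"
  is "\<lambda>X. if null2 X then (\<lambda>n. 0) else (\<lambda>n. inverse (X n))"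
proof -
  fix X Y assume *: "rel2 X Y"
  note iff = rel2_null2_iff[OF *]
  show "rel2 (if null2 X then (\<lambda>n. 0) else (\<lambda>n. inverse (X n)))
     (if null2 Y then (\<lambda>n. 0) else (\<lambda>n. inverse (Y n)))"
  proof (cases "null2 X")
    case True
    then show ?thesis using iff by (simp add: rel2_refl)
  next
    case False
    then show ?thesis using iff * by (simp add: rel2_def cauchy2_inverse null2_diff_inverse)
  qed
qed

definition "x - y = x + - y" for x y :: Q2

definition "x div y = x * inverse y" for x y :: Q2

instance
proof
  fix a b c :: Q2
  show "a + b + c = a + (b + c)"
    by transfer (simp add: add.assoc cauchy2_add rel2_def null2_zero)
  show "a + b = b + a"
    by transfer (simp add: add.commute cauchy2_add rel2_def null2_zero)
  show "0 + a = a"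
    by transfer (simp add: rel2_def null2_zero)
  show "- a + a = 0"
    by transfer (simp add: rel2_def null2_zero)
  show "a - b = a + - b"
    by (rule minus_Q2_def)
  show "a * b * c = a * (b * c)"
    by transfer (simp add: mult.assoc cauchy2_mult rel2_def null2_zero)
  show "a * b = b * a"
    by transfer (simp add: mult.commute cauchy2_mult rel2_def null2_zero)
  show "1 * a = a"
    by transfer (simp add: rel2_def null2_zero)
  show "(a + b) * c = a * c + b * c"
    by transfer (simp add: distrib_right cauchy2_add cauchy2_mult rel2_def null2_zero)
  show "(0::Q2) \<noteq> 1"
    by transfer (simp add: rel2_def null2_def LIMSEQ_const_iff)
  show "inverse a * a = 1" if "a \<noteq> 0"
    using that
  proof transfer
    fix X assume X: "rel2 X X" "\<not> rel2 X (\<lambda>n. 0)"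
    then have c: "cauchy2 X" and n: "\<not> null2 X" by (auto simp: rel2_def)
    obtain b N where b: "b > 0" "\<And>n. n \<ge> N \<Longrightarrow> rat_abs2 (X n) > b"
      by (rule cauchy2_not_null2[OF c n]) blast
    have "X k \<noteq> 0" if "k \<ge> N" for k using b(1) b(2)[OF that] by auto
    then have "\<forall>\<^sub>F n in sequentially. rat_abs2 (inverse (X n) * X n - 1) = 0"
      unfolding eventually_sequentially by (intro exI[of _ N]) simp
    then have "null2 (\<lambda>n. inverse (X n) * X n - 1)"
      unfolding null2_def by (rule tendsto_eventually)
    then show "rel2 (\<lambda>n. (if null2 X then \<lambda>n. 0 else (\<lambda>n. inverse (X n))) n * X n) (\<lambda>n. 1)"
      using c n by (simp add: rel2_def cauchy2_mult cauchy2_inverse)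
  qed
  show "a div b = a * inverse b"
    by (rule divide_Q2_def)
  show "inverse (0::Q2) = 0"
    by transfer (simp add: rel2_refl null2_zero)
qed

end

text \<open>The extension of the absolute value by continuity.\<close>

lift_definition adic_abs :: "Q2 \<Rightarrow> real" is "\<lambda>X. lim (\<lambda>n. rat_abs2 (X n))"
proof -
  fix X Y assume *: "rel2 X Y"
  obtain L where L: "(\<lambda>n. rat_abs2 (X n)) \<longlonglongrightarrow> L"
    using cauchy2_convergent[of X] * by (auto simp: rel2_def convergent_def)
  have "(\<lambda>n. rat_abs2 (X n) - rat_abs2 (Y n)) \<longlonglongrightarrow> 0"
  proof (rule Lim_null_comparison)
    show "(\<lambda>n. rat_abs2 (X n - Y n)) \<longlonglongrightarrow> 0"
      using * by (simp add: rel2_def null2_def LIMSEQ_const_iff)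
  qed (simp add: rat_abs2_diff_abs)
  from tendsto_diff[OF L this] have "(\<lambda>n. rat_abs2 (Y n)) \<longlonglongrightarrow> L" by simp
  with L show "lim (\<lambda>n. rat_abs2 (X n)) = lim (\<lambda>n. rat_abs2 (Y n))"
    by (simp add: limI)
qed

lemma cauchy2_lim: "cauchy2 X \<Longrightarrow> (\<lambda>n. rat_abs2 (X n)) \<longlonglongrightarrow> lim (\<lambda>n. rat_abs2 (X n))"
  using cauchy2_convergent convergent_LIMSEQ_iff by blast

lemma adic_abs_nonneg [simp]: "0 \<le> adic_abs x"
proof transfer
  fix X assume "rel2 X X"
  then show "0 \<le> lim (\<lambda>n. rat_abs2 (X n))"
    by (intro LIMSEQ_le_const[OF cauchy2_lim]) (auto simp: rel2_def)
qed

lemma adic_abs_eq_0_iff [simp]: "adic_abs x = 0 \<longleftrightarrow> x = 0"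
proof transfer
  fix X assume "rel2 X X"
  then have "(\<lambda>n. rat_abs2 (X n)) \<longlonglongrightarrow> lim (\<lambda>n. rat_abs2 (X n))" "cauchy2 X"
    using cauchy2_lim by (auto simp: rel2_def)
  then show "lim (\<lambda>n. rat_abs2 (X n)) = 0 \<longleftrightarrow> rel2 X (\<lambda>n. 0)"
    unfolding rel2_def null2_def using limI[of "\<lambda>n. rat_abs2 (X n)" 0] by (simp, metis)
qed

lemma adic_abs_mult: "adic_abs (x * y) = adic_abs x * adic_abs y"
proof transfer
  fix X Y assume "rel2 X X" "rel2 Y Y"
  then show "lim (\<lambda>n. rat_abs2 (X n * Y n)) = lim (\<lambda>n. rat_abs2 (X n)) * lim (\<lambda>n. rat_abs2 (Y n))"
    unfolding rat_abs2_mult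
    by (intro limI tendsto_mult cauchy2_lim) (auto simp: rel2_def)
qed

lemma adic_abs_add_le: "adic_abs (x + y) \<le> max (adic_abs x) (adic_abs y)"
proof transfer
  fix X Y assume *: "rel2 X X" "rel2 Y Y"
  show "lim (\<lambda>n. rat_abs2 (X n + Y n)) \<le> max (lim (\<lambda>n. rat_abs2 (X n))) (lim (\<lambda>n. rat_abs2 (Y n)))"
  proof (rule LIMSEQ_le)
    show "(\<lambda>n. rat_abs2 (X n + Y n)) \<longlonglongrightarrow> lim (\<lambda>n. rat_abs2 (X n + Y n))"
      using * by (intro cauchy2_lim cauchy2_add) (auto simp: rel2_def)
    show "(\<lambda>n. max (rat_abs2 (X n)) (rat_abs2 (Y n))) \<longlonglongrightarrow>
        max (lim (\<lambda>n. rat_abs2 (X n))) (lim (\<lambda>n. rat_abs2 (Y n)))"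
      using * by (intro tendsto_max cauchy2_lim) (auto simp: rel2_def)
  qed (use rat_abs2_add_le in blast)
qed

lemma of_nat_Q2: "of_nat k = Q2 (\<lambda>n. of_nat k)"
proof (induction k)
  case 0
  show ?case by (simp add: zero_Q2_def)
next
  case (Suc k)
  have "rel2 (\<lambda>n. of_nat k) (\<lambda>n. of_nat k)" by (simp add: rel2_refl)
  then have "1 + Q2 (\<lambda>n. of_nat k) = Q2 (\<lambda>n. 1 + of_nat k)"
    by (simp add: one_Q2_def plus_Q2.abs_eq rel2_refl)
  then show ?case using Suc by simp
qed

lemma adic_abs_two: "adic_abs 2 = 1 / 2"
  using of_nat_Q2[of 2] adic_abs.abs_eq[of "\<lambda>n. of_nat 2"]
  by (simp add: rel2_refl rat_abs2_two)


section \<open>Ultrametrics, balls and dilations\<close>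

definition ultrametric :: "('a \<Rightarrow> 'a \<Rightarrow> real) \<Rightarrow> bool" where
  "ultrametric d \<longleftrightarrow> Metric_space UNIV d \<and> (\<forall>x y z. d x z \<le> max (d x y) (d y z))"

text \<open>
  Balls are closed and of positive radius. A ball is regarded as a set, so different radii may
  give the same ball.
\<close>

definition balls_at_zero :: "('a::zero \<Rightarrow> 'a \<Rightarrow> real) \<Rightarrow> 'a set set" where
  "balls_at_zero d = {Metric_space.mcball UNIV d 0 r | r. r > 0}"

definition maximal_proper_subball :: "('a::zero \<Rightarrow> 'a \<Rightarrow> real) \<Rightarrow> 'a set \<Rightarrow> 'a set \<Rightarrow> bool" where
  "maximal_proper_subball d C B \<longleftrightarrow>
     C \<in> balls_at_zero d \<and> C \<subset> B \<and> \<not> (\<exists>D \<in> balls_at_zero d. C \<subset> D \<and> D \<subset> B)"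

definition dilation :: "(Q2^2 \<Rightarrow> Q2^2 \<Rightarrow> real) \<Rightarrow> (Q2^2 \<Rightarrow> Q2^2) \<Rightarrow> bool" where
  "dilation d f \<longleftrightarrow>
     ultrametric d \<and> Vector_Spaces.linear (*s) (*s) f \<and>
     (\<forall>B \<in> balls_at_zero d. maximal_proper_subball d (f ` B) B)"

definition s_metric :: "real \<Rightarrow> Q2^2 \<Rightarrow> Q2^2 \<Rightarrow> real" where
  "s_metric q x y = max (q * adic_abs (x$1 - y$1)) (adic_abs (x$2 - y$2))"

definition U_matrix :: "Q2^2^2" where
  "U_matrix = vector [vector [1, 0], vector [1, 1]]"

definition q_metric :: "real \<Rightarrow> Q2^2 \<Rightarrow> Q2^2 \<Rightarrow> real" where
  "q_metric q x y = s_metric q (U_matrix *v x) (U_matrix *v y)"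

definition quincunx_matrix :: "Q2^2^2" where
  "quincunx_matrix = vector [vector [1, - 1], vector [1, 1]]"

end

theory Submission
  imports Defs
begin

text \<open>
  In the coordinates \<open>a = x\<^sub>1\<close>, \<open>b = x\<^sub>1 + x\<^sub>2\<close> the distance of \<open>x\<close> from the origin is
  \<open>max (q \<bar>a\<bar>) \<bar>b\<bar>\<close>. Because \<open>1/2 < q < 1\<close>, its possible nonzero values interlace as
  \<open>\<dots> < q < 1 < 2 q < 2 < \<dots>\<close>: as the radius grows, the bound on \<open>\<bar>b\<bar>\<close> and the bound on \<open>\<bar>a\<bar>\<close>
  double alternately. The balls at the origin therefore form one chain indexed by the integers,
  \<^item> \<open>B\<^sub>k = {\<bar>a\<bar> \<le> 2^\<lceil>k/2\<rceil>, \<bar>b\<bar> \<le> 2^\<lfloor>k/2\<rfloor>}\<close>,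

  \<^noindent> which is \<open>ball_chain\<close> below; lemma \<open>balls_at_zero_q_metric\<close> proves this description, and
  \<open>ball_chain_subset_iff\<close> that the chain is strictly increasing.

  The quincunx matrix sends \<open>(a, b)\<close> to \<open>(2a - b, 2a)\<close>. So the new \<open>b\<close> obeys half the old bound on
  \<open>\<bar>a\<bar>\<close>, and, since that half is at most the old bound on \<open>\<bar>b\<bar>\<close>, the new \<open>a\<close> obeys the old bound on
  \<open>\<bar>b\<bar>\<close>. This takes \<open>B\<^sub>k\<close> into \<open>B\<^sub>k\<^sub>-\<^sub>1\<close>, and the same estimates for the inverse map give
  equality (\<open>quincunx_image_ball_chain\<close>). No integer lies strictly between \<open>k - 1\<close> and \<open>k\<close>, so
  \<open>B\<^sub>k\<^sub>-\<^sub>1\<close> is a maximal proper subball of \<open>B\<^sub>k\<close>.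
\<close>

section \<open>The value group of the 2-adic absolute value\<close>

lemma two_powi_le_iff [simp]: "(2::real) powi m \<le> 2 powi n \<longleftrightarrow> m \<le> n"
  by (simp flip: powr_real_of_int')

lemma two_powi_less_iff [simp]: "(2::real) powi m < 2 powi n \<longleftrightarrow> m < n"
  by (simp flip: powr_real_of_int')

lemma log_two_powi: "log 2 (2 powi m) = of_int m"
  by (simp flip: powr_real_of_int')

text \<open>
  The absolute value of a 2-adic number is a limit of powers of two. Its base-2 logarithm is then a
  limit of integers, and the integers are closed in the reals.
\<close>

lemma adic_abs_values:
  assumes "x \<noteq> 0"
  obtains m :: int where "adic_abs x = 2 powi m"
proof -
  have "log 2 (adic_abs x) \<in> \<int>"
    using assms
  proof transfer
    fix X assume X: "rel2 X X" "\<not> rel2 X (\<lambda>n. 0)"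
    define L where "L = lim (\<lambda>n. rat_abs2 (X n))"
    have lim: "(\<lambda>n. rat_abs2 (X n)) \<longlonglongrightarrow> L"
      using X(1) by (simp add: L_def cauchy2_lim rel2_def)
    then have "L \<noteq> 0"
      using X by (auto simp: rel2_def null2_def)
    have log_lim: "(\<lambda>n. log 2 (rat_abs2 (X n))) \<longlonglongrightarrow> log 2 L"
      unfolding log_def using lim \<open>L \<noteq> 0\<close> by (intro tendsto_intros) auto
    (* Entries that vanish do no harm, since the convention ln 0 = 0 makes their logarithm 0. *)
    have "log 2 (rat_abs2 (X n)) \<in> \<int>" for n
    proof (cases "X n = 0")
      case True
      then show ?thesis by (simp add: log_def)
    next
      case False
      then have "log 2 (rat_abs2 (X n)) = of_int (- val2 (X n))"
        by (simp only: rat_abs2_def if_False log_two_powi)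
      then show ?thesis by (simp only: Ints_of_int)
    qed
    then show "log 2 (lim (\<lambda>n. rat_abs2 (X n))) \<in> \<int>"
      unfolding L_def[symmetric] by (rule closed_sequentially[OF closed_Ints _ log_lim])
  qed
  then obtain m :: int where m: "log 2 (adic_abs x) = of_int m"
    by (auto elim: Ints_cases)
  have "adic_abs x > 0"
    using assms by (simp add: order_less_le)
  then have "adic_abs x = 2 powr of_int m"
    using powr_log_cancel[of 2 "adic_abs x"] m by simp
  then show thesis
    using that by (simp add: powr_real_of_int')
qed

lemma adic_abs_less_powi_iff:
  "adic_abs x < 2 powi (n + 1) \<longleftrightarrow> adic_abs x \<le> 2 powi n"
proof (cases "x = 0")
  case False
  then obtain m where "adic_abs x = 2 powi m" by (rule adic_abs_values)
  then show ?thesis by simp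
qed (simp add: iffD2[OF adic_abs_eq_0_iff])

lemma adic_abs_one [simp]: "adic_abs 1 = 1"
  using adic_abs_mult[of 1 1] by simp

lemma adic_abs_minus [simp]: "adic_abs (- x) = adic_abs x"
proof -
  have "(adic_abs (- 1))\<^sup>2 = 1"
    using adic_abs_mult[of "- 1" "- 1"] by (simp add: power2_eq_square)
  then have "adic_abs (- 1) = 1"
    using adic_abs_nonneg[of "- 1"] by (simp add: power2_eq_1_iff)
  then show ?thesis
    using adic_abs_mult[of "- 1" x] by simp
qed

lemma adic_abs_diff_le: "adic_abs (x - y) \<le> max (adic_abs x) (adic_abs y)"
  using adic_abs_add_le[of x "- y"] by simp

lemma adic_abs_diff_triangle:
  "adic_abs (x - z) \<le> max (adic_abs (x - y)) (adic_abs (y - z))"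
  using adic_abs_add_le[of "x - y" "y - z"] by simp

lemma adic_abs_power: "adic_abs (x ^ n) = adic_abs x ^ n"
  by (induction n) (simp_all add: adic_abs_mult)

lemma adic_abs_inverse: "adic_abs (inverse x) = inverse (adic_abs x)"
proof (cases "x = 0")
  case False
  then have "adic_abs x * adic_abs (inverse x) = 1"
    by (simp flip: adic_abs_mult)
  then show ?thesis by (simp add: inverse_unique)
next
  case True
  then show ?thesis by (metis adic_abs_eq_0_iff inverse_zero)
qed

lemma adic_abs_powi: "adic_abs (x powi k) = adic_abs x powi k"
  by (simp add: power_int_def adic_abs_power adic_abs_inverse)

lemma adic_abs_attains: obtains x where "adic_abs x = 2 powi n"
proof
  show "adic_abs (2 powi (- n)) = 2 powi n"
    unfolding adic_abs_powi adic_abs_two by (simp add: power_int_divide_distrib power_int_minus_divide)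
qed

section \<open>The two ultrametrics\<close>

lemma ultrametricI:
  fixes d :: "'a \<Rightarrow> 'a \<Rightarrow> real"
  assumes "\<And>x y. 0 \<le> d x y" "\<And>x y. d x y = d y x" "\<And>x y. d x y = 0 \<longleftrightarrow> x = y"
    "\<And>x y z. d x z \<le> max (d x y) (d y z)"
  shows "ultrametric d"
  unfolding ultrametric_def
proof
  have "d x z \<le> d x y + d y z" for x y z
    using assms(4)[of x z y] assms(1)[of x y] assms(1)[of y z] by linarith
  then show "Metric_space UNIV d"
    by unfold_locales (rule assms(1) assms(2) assms(3) | assumption)+
qed (use assms in blast)

lemma ultrametric_s_metric:
  assumes "0 < q"
  shows "ultrametric (s_metric q)"
proof (rule ultrametricI)
  fix x y z :: "Q2^2"
  show "0 \<le> s_metric q x y"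
    by (simp add: s_metric_def le_max_iff_disj)
  show "s_metric q x y = s_metric q y x"
    by (metis adic_abs_minus minus_diff_eq s_metric_def)
  have "0 \<le> q * adic_abs (x$1 - y$1)"
    using assms by simp
  then have "s_metric q x y = 0 \<longleftrightarrow> q * adic_abs (x$1 - y$1) = 0 \<and> adic_abs (x$2 - y$2) = 0"
    unfolding s_metric_def using adic_abs_nonneg[of "x$2 - y$2"] by linarith
  then show "s_metric q x y = 0 \<longleftrightarrow> x = y"
    using assms by (simp add: vec_eq_iff forall_2)
  have "q * adic_abs (x$1 - z$1) \<le> max (q * adic_abs (x$1 - y$1)) (q * adic_abs (y$1 - z$1))"
    using mult_left_mono[OF adic_abs_diff_triangle[of "x$1" "z$1" "y$1"], of q] assms
    by (simp add: max_mult_distrib_left)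
  with adic_abs_diff_triangle[of "x$2" "z$2" "y$2"]
  show "s_metric q x z \<le> max (s_metric q x y) (s_metric q y z)"
    unfolding s_metric_def by linarith
qed

lemma ultrametric_pullback:
  assumes "ultrametric d" "inj f"
  shows "ultrametric (\<lambda>x y. d (f x) (f y))"
proof -
  interpret Metric_space UNIV d
    using assms(1) by (simp add: ultrametric_def)
  show ?thesis
  proof (rule ultrametricI)
    show "d (f x) (f y) = d (f y) (f x)" for x y by (rule commute)
  qed (use assms in \<open>simp_all add: ultrametric_def inj_eq\<close>)
qed

lemma U_matrix_mult: "U_matrix *v x = vector [x$1, x$1 + x$2]"
  by (simp add: U_matrix_def vec_eq_iff forall_2 matrix_vector_mult_def sum_2)

lemma quincunx_mult: "quincunx_matrix *v x = vector [x$1 - x$2, x$1 + x$2]"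
  by (simp add: quincunx_matrix_def vec_eq_iff forall_2 matrix_vector_mult_def sum_2)

lemma inj_U_matrix: "inj (\<lambda>x. U_matrix *v x)"
  by (rule injI) (auto simp: U_matrix_mult vec_eq_iff forall_2)

lemma q_metric_eq:
  "q_metric q x y = max (q * adic_abs (x$1 - y$1)) (adic_abs (x$1 + x$2 - y$1 - y$2))"
  by (simp add: q_metric_def s_metric_def U_matrix_mult diff_diff_eq)

lemma ultrametric_q_metric: "0 < q \<Longrightarrow> ultrametric (q_metric q)"
  unfolding q_metric_def
  by (rule ultrametric_pullback[OF ultrametric_s_metric inj_U_matrix])

section \<open>The chain of balls and the action of the quincunx matrix\<close>

text \<open>
  The exponents are \<open>\<lceil>k/2\<rceil>\<close> and \<open>\<lfloor>k/2\<rfloor>\<close>: going from \<open>k\<close> to \<open>k + 1\<close> raises the first one if \<open>k\<close> is even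
  and the second one if \<open>k\<close> is odd.
\<close>

definition ball_chain :: "int \<Rightarrow> (Q2^2) set" where
  "ball_chain k =
     {x. adic_abs (x$1) \<le> 2 powi ((k + 1) div 2) \<and> adic_abs (x$1 + x$2) \<le> 2 powi (k div 2)}"

text \<open>
  A point of \<open>ball_chain j\<close> whose two coordinates have the largest absolute values that are allowed
  there lies in \<open>ball_chain i\<close> only if neither exponent decreases from \<open>j\<close> to \<open>i\<close>.
\<close>

lemma ball_chain_subset_iff: "ball_chain j \<subseteq> ball_chain i \<longleftrightarrow> j \<le> i"
proof
  assume sub: "ball_chain j \<subseteq> ball_chain i"
  obtain a where a: "adic_abs a = 2 powi ((j + 1) div 2)" by (rule adic_abs_attains)
  obtain b where b: "adic_abs b = 2 powi (j div 2)" by (rule adic_abs_attains)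
  have "vector [a, b - a] \<in> ball_chain j"
    by (simp add: ball_chain_def a b)
  then have "vector [a, b - a] \<in> ball_chain i"
    using sub by blast
  then have "(j + 1) div 2 \<le> (i + 1) div 2" "j div 2 \<le> i div 2"
    by (simp_all add: ball_chain_def a b)
  then show "j \<le> i" by presburger
next
  assume "j \<le> i"
  then have le: "(2::real) powi ((j + 1) div 2) \<le> 2 powi ((i + 1) div 2)"
    "(2::real) powi (j div 2) \<le> 2 powi (i div 2)"
    by (auto intro!: zdiv_mono1)
  show "ball_chain j \<subseteq> ball_chain i"
    unfolding ball_chain_def using le by (blast intro: order_trans)
qed

lemma ball_chain_psubset_iff: "ball_chain j \<subset> ball_chain i \<longleftrightarrow> j < i"
  by (auto simp: less_le_not_le ball_chain_subset_iff)

text \<open>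
  Half the bound on \<open>x\<^sub>1\<close> is at most the bound on \<open>x\<^sub>1 + x\<^sub>2\<close>. The ultrametric inequality, applied to
  \<open>x\<^sub>1 - x\<^sub>2 = 2x\<^sub>1 - (x\<^sub>1 + x\<^sub>2)\<close> and to \<open>y\<^sub>2 = (y\<^sub>1 + y\<^sub>2) - y\<^sub>1\<close>, gives the two inclusions.
\<close>

lemma quincunx_image_ball_chain:
  "(\<lambda>x. quincunx_matrix *v x) ` ball_chain k = ball_chain (k - 1)"
proof -
  (* v bounds x1 + x2 in ball_chain k and y1 in ball_chain (k - 1); u bounds 2 x1 and y1 + y2. *)
  define u v :: real where "u = 2 powi ((k - 1) div 2)" and "v = 2 powi (k div 2)"
  have "u \<le> v"
    unfolding u_def v_def by (intro power_int_increasing zdiv_mono1) auto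
  have "(k + 1) div 2 = (k - 1) div 2 + 1" by presburger
  then have two_u: "2 powi ((k + 1) div 2) = 2 * u"
    by (simp add: u_def power_int_add)
  have half: "adic_abs (2 * x) \<le> u \<longleftrightarrow> adic_abs x \<le> 2 * u" for x
    by (auto simp: adic_abs_mult adic_abs_two)
  have "quincunx_matrix *v x \<in> ball_chain (k - 1)" if "x \<in> ball_chain k" for x
  proof -
    have a: "adic_abs (2 * x$1) \<le> u" and b: "adic_abs (x$1 + x$2) \<le> v"
      using that by (simp_all add: ball_chain_def half two_u v_def)
    have "x$1 - x$2 = 2 * x$1 - (x$1 + x$2)" by simp
    then have "adic_abs (x$1 - x$2) \<le> v"
      using adic_abs_diff_le[of "2 * x$1" "x$1 + x$2"] a b \<open>u \<le> v\<close> by simp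
    with a show ?thesis
      by (simp add: quincunx_mult ball_chain_def u_def v_def)
  qed
  moreover have "y \<in> (\<lambda>x. quincunx_matrix *v x) ` ball_chain k" if "y \<in> ball_chain (k - 1)" for y
  proof
    (* The preimage of y under the quincunx matrix. *)
    define x :: "Q2^2" where "x = vector [(y$1 + y$2) / 2, (y$2 - y$1) / 2]"
    have nz: "(2::Q2) \<noteq> 0"
      using adic_abs_two by (metis adic_abs_eq_0_iff divide_eq_0_iff zero_neq_numeral zero_neq_one)
    have a: "2 * x$1 = y$1 + y$2" and b: "x$1 + x$2 = y$2" and c: "x$1 - x$2 = y$1"
      using nz by (simp_all add: x_def flip: add_divide_distrib diff_divide_distrib)
    show "y = quincunx_matrix *v x"
      by (simp add: quincunx_mult vec_eq_iff forall_2 a b c)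
    have 1: "adic_abs (y$1) \<le> v" and 2: "adic_abs (y$1 + y$2) \<le> u"
      using that by (simp_all add: ball_chain_def u_def v_def)
    have "adic_abs (y$2) \<le> v"
      using adic_abs_diff_le[of "y$1 + y$2" "y$1"] 1 2 \<open>u \<le> v\<close> by simp
    with 2 show "x \<in> ball_chain k"
      by (simp add: ball_chain_def b two_u half[symmetric] a flip: v_def)
  qed
  ultimately show ?thesis by blast
qed

section \<open>The balls at the origin\<close>

lemma q_ball_eq:
  assumes "0 < q"
  shows "Metric_space.mcball UNIV (q_metric q) 0 r =
    {x. q * adic_abs (x$1) \<le> r \<and> adic_abs (x$1 + x$2) \<le> r}"
proof -
  interpret Metric_space UNIV "q_metric q"
    using ultrametric_q_metric[OF assms] by (simp add: ultrametric_def)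
  have "q_metric q 0 x = max (q * adic_abs (x$1)) (adic_abs (x$1 + x$2))" for x
    by (subst commute) (simp_all add: q_metric_eq)
  then show ?thesis
    by (simp add: mcball_def)
qed

text \<open>
  Discreteness of the value group: the radius of a 2-adic ball can be rounded down to a power of two.
\<close>

lemma adic_abs_le_iff:
  assumes "2 powi n \<le> r" "r < 2 powi (n + 1)"
  shows "adic_abs x \<le> r \<longleftrightarrow> adic_abs x \<le> 2 powi n"
  using assms adic_abs_less_powi_iff[of x n] by linarith

text \<open>
  While \<open>r\<close> runs from \<open>2^n\<close> to \<open>2^(n + 1)\<close>, the bound \<open>r\<close> on \<open>x\<^sub>1 + x\<^sub>2\<close> rounds down to \<open>2^n\<close>
  throughout, but the bound \<open>r / q\<close> on \<open>x\<^sub>1\<close> crosses the power \<open>2^(n + 1)\<close> at \<open>r = q 2^(n + 1)\<close>. Below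
  this threshold the ball has an even index, from it on an odd one. The bounds \<open>1/2 < q < 1\<close> ensure
  that the threshold lies inside the range of \<open>r\<close> and that \<open>r / q\<close> stays between \<open>2^n\<close> and
  \<open>2^(n + 2)\<close>.
\<close>

lemma q_ball_even:
  assumes "1 / 2 < q" "2 powi n \<le> r" "r < q * 2 powi (n + 1)" "q < 1"
  shows "Metric_space.mcball UNIV (q_metric q) 0 r = ball_chain (2 * n)"
proof -
  have q: "0 < q" using assms by simp
  have p: "(0::real) < 2 powi (n + 1)" by simp
  have "r < 2 powi (n + 1)"
    using assms(3) mult_strict_right_mono[OF assms(4) p] by linarith
  moreover have "2 powi n \<le> r / q"
  proof -
    have "q * 2 powi n \<le> 1 * 2 powi n" using assms by (intro mult_right_mono) auto
    then have "q * 2 powi n \<le> r" using assms(2) by linarith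
    then show ?thesis using q by (simp add: field_simps)
  qed
  moreover have "r / q < 2 powi (n + 1)"
    using assms(3) q by (simp add: field_simps)
  ultimately have "(q * adic_abs a \<le> r \<longleftrightarrow> adic_abs a \<le> 2 powi n) \<and>
      (adic_abs b \<le> r \<longleftrightarrow> adic_abs b \<le> 2 powi n)" for a b
    using adic_abs_le_iff[of n r b] adic_abs_le_iff[of n "r / q" a] assms(2) q
    by (simp add: pos_le_divide_eq mult.commute)
  then show ?thesis
    by (simp add: q_ball_eq[OF q] ball_chain_def)
qed

lemma q_ball_odd:
  assumes "1 / 2 < q" "q * 2 powi (n + 1) \<le> r" "r < 2 powi (n + 1)"
  shows "Metric_space.mcball UNIV (q_metric q) 0 r = ball_chain (2 * n + 1)"
proof -
  have q: "0 < q" using assms by simp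
  have p: "(0::real) < 2 powi n" "2 powi (n + 1) = 2 * (2::real) powi n"
    "2 powi (n + 1 + 1) = 4 * (2::real) powi n"
    by (simp_all add: power_int_add)
  have "(1 / 2) * 2 powi (n + 1) \<le> q * 2 powi (n + 1)"
    using assms(1) by (intro mult_right_mono) auto
  then have "2 powi n \<le> r"
    using assms(2) p by linarith
  moreover have "2 powi (n + 1) \<le> r / q"
    using assms(2) q by (simp add: field_simps)
  moreover have "r / q < 2 powi (n + 1 + 1)"
  proof -
    have "(1 / 2) * 2 powi (n + 1 + 1) < q * 2 powi (n + 1 + 1)"
      using assms(1) by (intro mult_strict_right_mono) auto
    then have "r < q * 2 powi (n + 1 + 1)"
      using assms(3) p by linarith
    then show ?thesis using q by (simp add: field_simps)
  qed
  ultimately have "(q * adic_abs a \<le> r \<longleftrightarrow> adic_abs a \<le> 2 powi (n + 1)) \<and>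
      (adic_abs b \<le> r \<longleftrightarrow> adic_abs b \<le> 2 powi n)" for a b
    using adic_abs_le_iff[of n r b] adic_abs_le_iff[of "n + 1" "r / q" a] assms(3) q
    by (simp add: pos_le_divide_eq mult.commute)
  moreover have "(2 * n + 1 + 1) div 2 = n + 1" "(2 * n + 1) div 2 = n" by presburger+
  ultimately show ?thesis
    unfolding q_ball_eq[OF q] ball_chain_def by (simp only:)
qed

lemma powi_bracket:
  assumes "(0::real) < r"
  obtains n :: int where "2 powi n \<le> r" "r < 2 powi (n + 1)"
proof -
  define n where "n = \<lfloor>log 2 r\<rfloor>"
  have "2 powr of_int n \<le> r" "r < 2 powr (of_int (n + 1))"
    using assms unfolding n_def
    by (simp_all add: le_log_iff[symmetric] log_less_iff[symmetric])
  then show thesis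
    using that powr_real_of_int'[of 2 n] powr_real_of_int'[of 2 "n + 1"] by simp
qed

lemma balls_at_zero_q_metric:
  assumes "1 / 2 < q" "q < 1"
  shows "balls_at_zero (q_metric q) = range ball_chain"
proof
  show "balls_at_zero (q_metric q) \<subseteq> range ball_chain"
  proof
    fix B assume "B \<in> balls_at_zero (q_metric q)"
    then obtain r where r: "r > 0" "B = Metric_space.mcball UNIV (q_metric q) 0 r"
      by (auto simp: balls_at_zero_def)
    obtain n where n: "2 powi n \<le> r" "r < 2 powi (n + 1)"
      using powi_bracket[OF r(1)] .
    show "B \<in> range ball_chain"
      using q_ball_even[of q n r] q_ball_odd[of q n r] n assms r
      by (cases "r < q * 2 powi (n + 1)") auto
  qed
  show "range ball_chain \<subseteq> balls_at_zero (q_metric q)"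
  proof
    fix B assume "B \<in> range ball_chain"
    then obtain k where B: "B = ball_chain k" by blast
    have p: "(0::real) < 2 powi n" "2 powi (n + 1) = 2 * (2::real) powi n" for n :: int
      by (simp_all add: power_int_add)
    show "B \<in> balls_at_zero (q_metric q)"
    proof (cases "even k")
      case True
      then obtain n where k: "k = 2 * n" by blast
      have "2 powi n < q * 2 powi (n + 1)"
        using assms p by simp
      then show ?thesis
        using q_ball_even[of q n "2 powi n"] assms p(1)[of n]
        unfolding balls_at_zero_def B k by blast
    next
      case False
      then obtain n where k: "k = 2 * n + 1" by (elim oddE)
      have "q * 2 powi (n + 1) < 2 powi (n + 1)" "0 < q * 2 powi (n + 1)"
        using assms p(1)[of "n + 1"] by simp_all
      then show ?thesis
        using q_ball_odd[of q n "q * 2 powi (n + 1)"] assms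
        unfolding balls_at_zero_def B k by blast
    qed
  qed
qed

theorem lemma10:
  fixes q :: real
  assumes "1 / 2 < q" and "q < 1"
  shows "ultrametric (s_metric q) \<and>
    (\<forall>x y. q_metric q x y =
       max (q * adic_abs (x$1 - y$1)) (adic_abs (x$1 + x$2 - y$1 - y$2))) \<and>
    dilation (q_metric q) (\<lambda>x. quincunx_matrix *v x)"
proof (intro conjI allI)
  have q: "0 < q" using assms by simp
  show "ultrametric (s_metric q)"
    using q by (rule ultrametric_s_metric)
  show "q_metric q x y =
      max (q * adic_abs (x$1 - y$1)) (adic_abs (x$1 + x$2 - y$1 - y$2))" for x y
    by (rule q_metric_eq)
  have "maximal_proper_subball (q_metric q) (ball_chain (k - 1)) (ball_chain k)" for k
    unfolding maximal_proper_subball_def balls_at_zero_q_metric[OF assms]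
    by (auto simp: ball_chain_psubset_iff)
  then show "dilation (q_metric q) (\<lambda>x. quincunx_matrix *v x)"
    unfolding dilation_def balls_at_zero_q_metric[OF assms]
    using ultrametric_q_metric[OF q] matrix_vector_mul_linear_gen
    by (auto simp: quincunx_image_ball_chain)
qed

end
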